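(* Let $\alpha\in(0,1)$ be irrational, let $T(x)=(x+\alpha)\bmod 1$ on the circle $\mathbb{R}/\mathbb{Z}$ (represented by $[0,1)$), and let $\mathcal{P}=\{[0,1-\alpha),[1-\alpha,1)\}$. Let $n\geq 1$ be an integer. If $\mathcal{R}$ is a non-trivial partition of the circle that is rougher than $\mathcal{P}^n$, then there exist $k,\ell,m\in\mathbb{N}$ (with $k,m\ge 1$) such that $\ell<n$ and $$\mathcal{R}^k=T^{-\ell}\mathcal{P}^{m}=\left(T^{-\ell}\mathcal{P}\right)^{m}.$$ In other words, $\mathcal{R}^k$ is the partition of the unit circle into left-closed right-open intervals whose endpoints are the points $T^{-i}(0)$, $i\in\mathbb{N}$, $\ell\leq i\leq \ell+m$.
   Context: $\mathbb{N}$ contains $0$. A partition of a set $X$ is a set of non-empty pairwise disjoint subsets covering $X$; it is non-trivial if it has at least two elements. A partition $\mathcal{R}$ is rougher than $\mathcal{R}'$ (equivalently $\mathcal{R}'$ is finer than $\mathcal{R}$) if every element of $\mathcal{R}'$ is a subset of an element of $\mathcal{R}$ (equality of partitions is allowed). For a partition $\mathcal{R}$ and an integer $j$, $T^{-j}\mathcal{R}=\{T^{-j}R : R\in\mathcal{R}\}$. For $n\geq 1$ the $n$-th refinement of $\mathcal{R}$ is $$\mathcal{R}^{n}=\Big\{\bigcap_{j=0}^{n-1}T^{-j}R_j : R_0,\ldots,R_{n-1}\in\mathcal{R}\Big\}\setminus\{\emptyset\}.$$ Intervals are understood in the circle $\mathbb{R}/\mathbb{Z}$. *)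

theory Defs
  imports Complex_Main "HOL-Library.Disjoint_Sets"
begin

(* The circle R/Z is represented by the fundamental domain [0,1). *)
definition circle :: "real set" where
  "circle = {0..<1}"

definition rot :: "real \<Rightarrow> real \<Rightarrow> real" where
  "rot \<alpha> x = frac (x + \<alpha>)"

(* The set T^{-j} A; the intersection is needed because rot is defined on all of the reals. *)
definition rot_preimage :: "real \<Rightarrow> nat \<Rightarrow> real set \<Rightarrow> real set" where
  "rot_preimage \<alpha> j A = ((rot \<alpha> ^^ j) -` A) \<inter> circle"

definition pull_partition :: "real \<Rightarrow> nat \<Rightarrow> real set set \<Rightarrow> real set set" where
  "pull_partition \<alpha> j \<R> = rot_preimage \<alpha> j ` \<R>"

(* Meaningful for n >= 1 only: for n = 0 the empty intersection is UNIV. *)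
definition refinement :: "real \<Rightarrow> nat \<Rightarrow> real set set \<Rightarrow> real set set" where
  "refinement \<alpha> n \<R> =
     {\<Inter>j<n. rot_preimage \<alpha> j (R j) | R. \<forall>j<n. R j \<in> \<R>} - {{}}"

definition rot_partition :: "real \<Rightarrow> real set set" where
  "rot_partition \<alpha> = {{0..<1 - \<alpha>}, {1 - \<alpha>..<1}}"

(* The left-closed right-open interval [a,b) of the circle, for distinct a and b in [0,1);
   it passes through 0 if b < a. *)
definition arc :: "real \<Rightarrow> real \<Rightarrow> real set" where
  "arc a b = (if a < b then {a..<b} else {a..<1} \<union> {0..<b})"

(* Q is a partition of the circle into left-closed right-open intervals, and E is exactly
   the set of their endpoints. *)
definition interval_partition :: "real set \<Rightarrow> real set set \<Rightarrow> bool" where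
  "interval_partition E Q \<longleftrightarrow>
     E \<subseteq> circle \<and> partition_on circle Q \<and>
     (\<forall>I\<in>Q. \<exists>a\<in>E. \<exists>b\<in>E. a \<noteq> b \<and> I = arc a b) \<and>
     (\<forall>e\<in>E. \<exists>a\<in>E. a \<noteq> e \<and> (arc a e \<in> Q \<or> arc e a \<in> Q))"

end

theory Submission
  imports Defs "HOL-Analysis.Kronecker_Approximation_Theorem"
begin

text \<open>
  Colour a point by the atom of \<open>\<R>\<close> containing it. The colouring is piecewise constant and jumps
  only at points \<open>- i \<alpha>\<close> with \<open>i \<le> n\<close>; let \<open>l\<close> and \<open>L\<close> be the least and greatest such \<open>i\<close>, which differ
  since \<open>\<R>\<close> is non-trivial. For \<open>k \<ge> L\<close> the itineraries of length \<open>k\<close> jump only at the points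
  \<open>- i \<alpha>\<close> with \<open>l \<le> i \<le> L + k - 1\<close>, so it remains to see that different arcs between these points have
  different itineraries once \<open>k\<close> is large. Two close points separated by such a point are moved by the
  rotation to the two sides of a jump of the colouring. If points at distance at least \<open>\<delta>\<close> could not
  be separated in bounded time, then compactness, one-sided continuity and uniform density of
  orbits would yield a translation preserving the colouring. It would permute the finitely many jumps, which lie in
  one orbit of the irrational rotation, and hence be trivial.
\<close>

section \<open>Irrational rotations\<close>

text \<open>Two such points differ by \<open>d * \<alpha>\<close> minus an integer, with
  \<open>|d| \<le> n\<close>. For each of the finitely many \<open>d \<noteq> 0\<close>,
  irrationality keeps \<open>d * \<alpha>\<close> at a positive distance from the integers.\<close>

lemma irrational_orbit_gap:
  fixes \<alpha> :: real
  assumes "\<alpha> \<notin> \<rat>"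
  obtains \<delta> where "0 < \<delta>" "\<delta> \<le> 1"
    "\<And>i i' p p'. i \<le> n \<Longrightarrow> i' \<le> n \<Longrightarrow>
      \<bar>(of_int p - real i * \<alpha>) - (of_int p' - real i' * \<alpha>)\<bar> < \<delta> \<Longrightarrow> i = i' \<and> p = p'"
proof -
  define g where "g d = \<bar>of_int d * \<alpha> - of_int (round (of_int d * \<alpha>))\<bar>" for d :: int
  \<comment> \<open>The inserted 1 ensures \<open>\<delta> \<le> 1\<close>, which separates the
    integer translates of a single point, and keeps the set non-empty for
    \<open>n = 0\<close>.\<close>
  define S where "S = insert 1 (g ` ({- int n..int n} - {0}))"
  have fin: "finite S" "S \<noteq> {}" by (auto simp: S_def)
  have pos: "0 < g d" if "d \<noteq> 0" for d
  proof -
    have "of_int d * \<alpha> \<notin> \<rat>"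
    proof
      assume "of_int d * \<alpha> \<in> \<rat>"
      then have "of_int d * \<alpha> / of_int d \<in> \<rat>" by (intro Rats_divide) auto
      then show False using that assms by simp
    qed
    then have "of_int d * \<alpha> \<noteq> of_int (round (of_int d * \<alpha>))" by (metis Rats_of_int)
    then show ?thesis by (simp add: g_def)
  qed
  show thesis
  proof
    show "0 < Min S" using fin pos by (auto simp: S_def)
    show "Min S \<le> 1" using fin by (auto simp: S_def)
    fix i i' p p'
    assume i: "i \<le> n" "i' \<le> n"
      and lt: "\<bar>(of_int p - real i * \<alpha>) - (of_int p' - real i' * \<alpha>)\<bar> < Min S"
    define d where "d = int i' - int i"
    have eq: "(of_int p - real i * \<alpha>) - (of_int p' - real i' * \<alpha>) = of_int d * \<alpha> - of_int (p' - p)"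
      by (simp add: d_def algebra_simps)
    have "d = 0"
    proof (rule ccontr)
      assume "d \<noteq> 0"
      then have "g d \<in> S" using i by (auto simp: S_def d_def)
      then have "Min S \<le> g d" using fin by simp
      also have "g d \<le> \<bar>of_int d * \<alpha> - of_int (p' - p)\<bar>"
        unfolding g_def using round_diff_minimal[of "of_int d * \<alpha>" "p' - p"] by (simp add: abs_minus_commute)
      finally show False using lt unfolding eq by simp
    qed
    moreover have "\<bar>of_int d * \<alpha> - of_int (p' - p)\<bar> < 1"
      using lt eq \<open>Min S \<le> 1\<close> by simp
    ultimately have "\<bar>of_int (p' - p) :: real\<bar> < 1" by simp
    then have "p' - p = 0" by linarith
    with \<open>d = 0\<close> show "i = i' \<and> p = p'" by (simp add: d_def)
  qed
qed

text \<open>Dirichlet approximation gives a non-zero displacement shorter than \<open>w\<close>.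
  Steps of that size cannot leap over an interval of length \<open>w\<close>, and a bounded number
  of them goes round the circle, so one \<open>N\<close> serves all \<open>x\<close> and
  \<open>z\<close>.\<close>

lemma orbit_uniformly_dense:
  fixes \<alpha> :: real
  assumes "\<alpha> \<notin> \<rat>" "0 < w"
  obtains N where "\<And>x z. \<exists>j<N. \<exists>p::int. z < x + real j * \<alpha> + of_int p \<and> x + real j * \<alpha> + of_int p < z + w"
proof -
  obtain M :: nat where M: "M > 0" "1 / M < w"
    by (metis assms(2) gr_zeroI inverse_eq_divide real_arch_inverse)
  obtain h k where k: "0 < k" "\<bar>of_int k * \<alpha> - of_int h\<bar> < 1 / M"
    using Dirichlet_approx[OF M(1)] by metis
  define \<gamma> where "\<gamma> = of_int k * \<alpha> - of_int h"
  have "\<gamma> \<noteq> 0"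
  proof
    assume "\<gamma> = 0"
    then have "\<alpha> = of_int h / of_int k" using k by (simp add: \<gamma>_def field_simps)
    then show False using assms by (metis Rats_divide Rats_of_int)
  qed
  have small: "\<bar>\<gamma>\<bar> < w" using k M by (simp add: \<gamma>_def)
  define B where "B = nat \<lceil>1 / \<bar>\<gamma>\<bar>\<rceil> + 2"
  define N where "N = nat k * B"
  \<comment> \<open>The first step past \<open>z\<close> overshoots by at most
    \<open>|\<gamma>| < w\<close>; its number is at most \<open>1 / |\<gamma>| + 1\<close>, which is
    below \<open>B\<close>.\<close>
  have hit: "\<exists>t<B. z < u + real t * \<bar>\<gamma>\<bar> \<and> u + real t * \<bar>\<gamma>\<bar> < z + w"
    if "u \<le> z" "z < u + 1" for u z
  proof -
    define t where "t = nat (\<lfloor>(z - u) / \<bar>\<gamma>\<bar>\<rfloor> + 1)"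
    have nn: "0 \<le> (z - u) / \<bar>\<gamma>\<bar>" using that by simp
    then have rt: "real t = of_int \<lfloor>(z - u) / \<bar>\<gamma>\<bar>\<rfloor> + 1"
      by (simp add: t_def)
    have "(z - u) / \<bar>\<gamma>\<bar> < real t" "real t \<le> (z - u) / \<bar>\<gamma>\<bar> + 1"
      unfolding rt by linarith+
    then have "z - u < real t * \<bar>\<gamma>\<bar>" "real t * \<bar>\<gamma>\<bar> \<le> z - u + \<bar>\<gamma>\<bar>"
      using \<open>\<gamma> \<noteq> 0\<close> by (auto simp: field_simps)
    moreover have "t < B"
    proof -
      have "(z - u) / \<bar>\<gamma>\<bar> \<le> 1 / \<bar>\<gamma>\<bar>" using that by (intro divide_right_mono) auto
      then have "real t \<le> 1 / \<bar>\<gamma>\<bar> + 1" using \<open>real t \<le> (z - u) / \<bar>\<gamma>\<bar> + 1\<close> by linarith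
      then show ?thesis unfolding B_def by linarith
    qed
    ultimately show ?thesis using small by (intro exI[of _ t]) auto
  qed
  show thesis
  proof
    fix x z :: real
    have "\<exists>t<B. \<exists>q::int. z < x + of_int q + real t * \<gamma> \<and> x + of_int q + real t * \<gamma> < z + w"
    proof (cases "0 < \<gamma>")
      case True
      then have g: "\<bar>\<gamma>\<bar> = \<gamma>" by simp
      have "x + of_int \<lfloor>z - x\<rfloor> \<le> z" "z < x + of_int \<lfloor>z - x\<rfloor> + 1" by linarith+
      from hit[OF this] obtain t where t: "t < B"
        "z < x + of_int \<lfloor>z - x\<rfloor> + real t * \<gamma>" "x + of_int \<lfloor>z - x\<rfloor> + real t * \<gamma> < z + w"
        unfolding g by blast
      then show ?thesis by blast
    next
      case False
      then have g: "\<bar>\<gamma>\<bar> = - \<gamma>" by simp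
      \<comment> \<open>For a negative displacement, reflect and aim for the interval from
        \<open>- (z + w)\<close> to \<open>- z\<close>.\<close>
      have "- x + of_int \<lfloor>x - (z + w)\<rfloor> \<le> - (z + w)" "- (z + w) < - x + of_int \<lfloor>x - (z + w)\<rfloor> + 1"
        by linarith+
      from hit[OF this] obtain t where t: "t < B"
        "- (z + w) < - x + of_int \<lfloor>x - (z + w)\<rfloor> + real t * \<bar>\<gamma>\<bar>"
        "- x + of_int \<lfloor>x - (z + w)\<rfloor> + real t * \<bar>\<gamma>\<bar> < - (z + w) + w"
        by blast
      have "z < x + of_int (- \<lfloor>x - (z + w)\<rfloor>) + real t * \<gamma>" "x + of_int (- \<lfloor>x - (z + w)\<rfloor>) + real t * \<gamma> < z + w"
        using t(2,3) unfolding g by simp_all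
      then show ?thesis using t(1) by blast
    qed
    then obtain t q where t: "t < B"
      "z < x + of_int q + real t * \<gamma>" "x + of_int q + real t * \<gamma> < z + w" by blast
    have eq: "x + real (nat k * t) * \<alpha> + of_int (q - int t * h) = x + of_int q + real t * \<gamma>"
      using k by (simp add: \<gamma>_def algebra_simps)
    have "nat k * t < N" using t(1) k(1) by (simp add: N_def)
    then show "\<exists>j<N. \<exists>p::int. z < x + real j * \<alpha> + of_int p \<and> x + real j * \<alpha> + of_int p < z + w"
      using t(2,3) unfolding eq[symmetric] by blast
  qed
qed

text \<open>Right-continuity of the floor puts the point in \<open>(x, y]\<close>, which matches the
  convention of left-closed intervals.\<close>

lemma floor_neq_pointE:
  fixes x y a :: real
  assumes "\<lfloor>x + a\<rfloor> \<noteq> \<lfloor>y + a\<rfloor>" "x \<le> y"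
  obtains p where "x < of_int p - a" "of_int p - a \<le> y"
proof
  have "\<lfloor>x + a\<rfloor> < \<lfloor>y + a\<rfloor>" using assms floor_mono[of "x + a" "y + a"] by simp
  then show "x < of_int \<lfloor>y + a\<rfloor> - a" by linarith
  show "of_int \<lfloor>y + a\<rfloor> - a \<le> y" by linarith
qed

section \<open>Piecewise constant colourings\<close>

text \<open>The circle is lifted to the real line with \<open>F\<close> of period 1, so that
  crossing a lift of \<open>- i * \<alpha>\<close> becomes a change of the floor of
  \<open>x + i * \<alpha>\<close>. By \<open>constancy\<close>, \<open>F\<close> changes only at
  such crossings.\<close>

locale step_coloring =
  fixes \<alpha> \<delta> :: real and n :: nat and F :: "real \<Rightarrow> 'c"
  assumes irrational: "\<alpha> \<notin> \<rat>"
    and periodic: "\<And>x. F (x + 1) = F x"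
    and constancy: "\<And>x y. (\<And>i. i \<le> n \<Longrightarrow> \<lfloor>x + real i * \<alpha>\<rfloor> = \<lfloor>y + real i * \<alpha>\<rfloor>) \<Longrightarrow> F x = F y"
    and delta_pos: "0 < \<delta>" and delta_le_1: "\<delta> \<le> 1"
    and gap: "\<And>i i' p p'. i \<le> n \<Longrightarrow> i' \<le> n \<Longrightarrow>
      \<bar>(of_int p - real i * \<alpha>) - (of_int p' - real i' * \<alpha>)\<bar> < \<delta> \<Longrightarrow> i = i' \<and> p = p'"
begin

text \<open>
  \<open>F\<close> is constant on each side of \<open>- i \<alpha>\<close> within distance \<open>\<delta>\<close>, so comparing the values at
  distance \<open>\<delta> / 2\<close> to the left and at the point itself detects a discontinuity there.
\<close>

definition jumps :: "nat set" where
  "jumps = {i. i \<le> n \<and> F (- (real i * \<alpha>) - \<delta> / 2) \<noteq> F (- (real i * \<alpha>))}"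

lemma finite_jumps: "finite jumps"
  by (rule finite_subset[of _ "{..n}"]) (auto simp: jumps_def)

lemma periodic_of_nat: "F (x + real m) = F x"
proof (induction m)
  case (Suc m)
  have "F (x + real (Suc m)) = F (x + real m + 1)" by (simp add: algebra_simps)
  then show ?case using Suc periodic by simp
qed simp

lemma periodic_of_int: "F (x + of_int p) = F x"
proof (cases "p \<ge> 0")
  case True
  then show ?thesis using periodic_of_nat[of x "nat p"] by simp
next
  case False
  then show ?thesis using periodic_of_nat[of "x + of_int p" "nat (- p)"] by simp
qed

text \<open>By \<open>gap\<close> no other lift lies within \<open>\<delta>\<close> of
  \<open>d\<close>, so nothing is crossed between \<open>u\<close> and \<open>v\<close>.\<close>

lemma constant_left:
  assumes i: "i \<le> n" and d: "d = of_int p - real i * \<alpha>"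
    and "d - \<delta> < u" "u < d" "d - \<delta> < v" "v < d"
  shows "F u = F v"
proof -
  have *: "F u = F v" if "d - \<delta> < u" "u \<le> v" "v < d" for u v
  proof (rule constancy, rule ccontr)
    fix i' assume "i' \<le> n" and "\<lfloor>u + real i' * \<alpha>\<rfloor> \<noteq> \<lfloor>v + real i' * \<alpha>\<rfloor>"
    from this(2) \<open>u \<le> v\<close> obtain q where "u < of_int q - real i' * \<alpha>" "of_int q - real i' * \<alpha> \<le> v"
      by (rule floor_neq_pointE)
    then have "\<bar>d - (of_int q - real i' * \<alpha>)\<bar> < \<delta>" "of_int q - real i' * \<alpha> \<noteq> d" using that by auto
    then show False using gap[OF i \<open>i' \<le> n\<close>, of p q] d by auto
  qed
  show ?thesis
  proof (cases "u \<le> v")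
    case True
    then show ?thesis using * assms by blast
  next
    case False
    then show ?thesis using *[of v u] assms by simp
  qed
qed

lemma constant_right:
  assumes i: "i \<le> n" and d: "d = of_int p - real i * \<alpha>" and "d \<le> v" "v < d + \<delta>"
  shows "F d = F v"
proof (rule constancy, rule ccontr)
  fix i' assume "i' \<le> n" and "\<lfloor>d + real i' * \<alpha>\<rfloor> \<noteq> \<lfloor>v + real i' * \<alpha>\<rfloor>"
  from this(2) \<open>d \<le> v\<close> obtain q where "d < of_int q - real i' * \<alpha>" "of_int q - real i' * \<alpha> \<le> v"
    by (rule floor_neq_pointE)
  then have "\<bar>d - (of_int q - real i' * \<alpha>)\<bar> < \<delta>" "of_int q - real i' * \<alpha> \<noteq> d" using assms by auto
  then show False using gap[OF i \<open>i' \<le> n\<close>, of p q] d by auto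
qed

text \<open>Frees the test in \<open>jumps\<close> from its representative and offset: periodicity
  moves \<open>d\<close> to \<open>- i * \<alpha>\<close>, and \<open>F\<close> is constant on
  either side within \<open>\<delta>\<close>.\<close>

lemma jumps_iff:
  assumes i: "i \<le> n" and d: "d = of_int p - real i * \<alpha>"
    and u: "d - \<delta> < u" "u < d" and v: "d \<le> v" "v < d + \<delta>"
  shows "i \<in> jumps \<longleftrightarrow> F u \<noteq> F v"
proof -
  have "F u = F (d - \<delta> / 2)" using constant_left[OF i d u] delta_pos by auto
  also have "\<dots> = F (- (real i * \<alpha>) - \<delta> / 2)"
    using periodic_of_int[of "- (real i * \<alpha>) - \<delta> / 2" p] by (simp add: d algebra_simps)
  finally have 1: "F u = F (- (real i * \<alpha>) - \<delta> / 2)" .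
  have "F v = F d" using constant_right[OF i d v] by simp
  also have "\<dots> = F (- (real i * \<alpha>))"
    using periodic_of_int[of "- (real i * \<alpha>)" p] by (simp add: d algebra_simps)
  finally show ?thesis using 1 i by (simp add: jumps_def)
qed

lemma jump_separates:
  assumes i: "i \<in> jumps" and ne: "\<lfloor>x + real i * \<alpha>\<rfloor> \<noteq> \<lfloor>y + real i * \<alpha>\<rfloor>" and "x \<le> y" "y - x < \<delta>"
  shows "F x \<noteq> F y"
proof -
  obtain p where "x < of_int p - real i * \<alpha>" "of_int p - real i * \<alpha> \<le> y"
    using floor_neq_pointE[OF ne \<open>x \<le> y\<close>] .
  then show ?thesis using jumps_iff[of i _ p x y] i assms by (auto simp: jumps_def)
qed

text \<open>If a candidate point is crossed at all, its index is not a jump, and \<open>x\<close>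
  and \<open>y\<close> are close enough to it for \<open>jumps_iff\<close>.\<close>

lemma no_jump_local:
  assumes eq: "\<And>i. i \<in> jumps \<Longrightarrow> \<lfloor>x + real i * \<alpha>\<rfloor> = \<lfloor>y + real i * \<alpha>\<rfloor>" and "x \<le> y" "y - x < \<delta>"
  shows "F x = F y"
proof (cases "\<exists>i\<le>n. \<lfloor>x + real i * \<alpha>\<rfloor> \<noteq> \<lfloor>y + real i * \<alpha>\<rfloor>")
  case True
  then obtain i where i: "i \<le> n" "\<lfloor>x + real i * \<alpha>\<rfloor> \<noteq> \<lfloor>y + real i * \<alpha>\<rfloor>" by blast
  obtain p where "x < of_int p - real i * \<alpha>" "of_int p - real i * \<alpha> \<le> y"
    using floor_neq_pointE[OF i(2) \<open>x \<le> y\<close>] .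
  then show ?thesis using jumps_iff[of i _ p x y] i assms by auto
qed (use constancy in blast)

text \<open>Long distances are covered by steps of at most \<open>\<delta> / 2\<close>; floors are
  monotone, so they agree at the intermediate points too.\<close>

lemma no_jump:
  assumes eq: "\<And>i. i \<in> jumps \<Longrightarrow> \<lfloor>x + real i * \<alpha>\<rfloor> = \<lfloor>y + real i * \<alpha>\<rfloor>" and "x \<le> y"
  shows "F x = F y"
proof -
  have "F x = F y" if "\<And>i. i \<in> jumps \<Longrightarrow> \<lfloor>x + real i * \<alpha>\<rfloor> = \<lfloor>y + real i * \<alpha>\<rfloor>" "x \<le> y"
    "y - x \<le> real N * (\<delta> / 2)" for N y
    using that
  proof (induction N arbitrary: y)
    case 0
    then show ?case by simp
  next
    case (Suc N)
    define z where "z = max x (y - \<delta> / 2)"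
    have z: "x \<le> z" "z \<le> y" "y - z < \<delta>" "z - x \<le> real N * (\<delta> / 2)"
      using Suc.prems(2,3) delta_pos by (auto simp: z_def max_def algebra_simps)
    have fl: "\<lfloor>x + real i * \<alpha>\<rfloor> = \<lfloor>z + real i * \<alpha>\<rfloor> \<and> \<lfloor>z + real i * \<alpha>\<rfloor> = \<lfloor>y + real i * \<alpha>\<rfloor>" if "i \<in> jumps" for i
      using Suc.prems(1)[OF that] z(1,2) floor_mono[of "x + real i * \<alpha>" "z + real i * \<alpha>"]
        floor_mono[of "z + real i * \<alpha>" "y + real i * \<alpha>"] by simp
    have "F x = F z" using Suc.IH fl z by blast
    also have "\<dots> = F y" using no_jump_local fl z by blast
    finally show ?case .
  qed
  moreover obtain N where "(y - x) / (\<delta> / 2) \<le> real N" using real_arch_simple by blast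
  then have "y - x \<le> real N * (\<delta> / 2)" using delta_pos by (simp add: field_simps)
  ultimately show ?thesis using assms by blast
qed

text \<open>Cutting the circle at a single point leaves one arc, on which \<open>F\<close> would be
  constant.\<close>

lemma two_jumps:
  assumes "F a \<noteq> F b"
  shows "\<not> jumps \<subseteq> {i}"
proof
  assume sub: "jumps \<subseteq> {i}"
  \<comment> \<open>Integer translates of both points into the fundamental domain that starts at
    \<open>- i * \<alpha>\<close>.\<close>
  define a' b' where "a' = a - of_int \<lfloor>a + real i * \<alpha>\<rfloor>" and "b' = b - of_int \<lfloor>b + real i * \<alpha>\<rfloor>"
  have fl: "\<lfloor>a' + real j * \<alpha>\<rfloor> = \<lfloor>b' + real j * \<alpha>\<rfloor>" if "j \<in> jumps" for j
  proof -
    have "j = i" using that sub by auto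
    moreover have "\<lfloor>a' + real i * \<alpha>\<rfloor> = 0" "\<lfloor>b' + real i * \<alpha>\<rfloor> = 0"
      unfolding a'_def b'_def by linarith+
    ultimately show ?thesis by simp
  qed
  have "F a' = F b'"
  proof (cases "a' \<le> b'")
    case True
    then show ?thesis using fl by (intro no_jump) auto
  next
    case False
    then show ?thesis using fl by (intro no_jump[symmetric]) auto
  qed
  moreover have "F a' = F a" "F b' = F b"
    using periodic_of_int[of a' "\<lfloor>a + real i * \<alpha>\<rfloor>"] periodic_of_int[of b' "\<lfloor>b + real i * \<alpha>\<rfloor>"]
    by (auto simp: a'_def b'_def)
  ultimately show False using assms by simp
qed

section \<open>Translation symmetry and separation of distant points\<close>

lemma right_continuous:
  obtains \<epsilon> where "0 < \<epsilon>" "\<And>t. z \<le> t \<Longrightarrow> t < z + \<epsilon> \<Longrightarrow> F t = F z"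
proof -
  \<comment> \<open>The distances from \<open>z\<close> to the next lift of each
    \<open>- i * \<alpha>\<close> strictly to its right.\<close>
  define S where "S = (\<lambda>i. of_int (\<lfloor>z + real i * \<alpha>\<rfloor> + 1) - (z + real i * \<alpha>)) ` {..n}"
  have fin: "finite S" "S \<noteq> {}" by (auto simp: S_def)
  show thesis
  proof
    show "0 < Min S" using fin by (auto simp: S_def)
    fix t assume t: "z \<le> t" "t < z + Min S"
    show "F t = F z"
    proof (rule constancy)
      fix i assume "i \<le> n"
      then have "Min S \<le> of_int (\<lfloor>z + real i * \<alpha>\<rfloor> + 1) - (z + real i * \<alpha>)"
        using fin by (auto simp: S_def)
      then show "\<lfloor>t + real i * \<alpha>\<rfloor> = \<lfloor>z + real i * \<alpha>\<rfloor>" using t by linarith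
    qed
  qed
qed

text \<open>Away from the lifts of jumps, a small move to the left changes no floor with index in
  \<open>jumps\<close>, so \<open>no_jump\<close> rules out a discontinuity.\<close>

lemma left_discontinuity:
  assumes "0 < \<epsilon>" "\<And>s. 0 < s \<Longrightarrow> s < \<epsilon> \<Longrightarrow> F (w - s) \<noteq> F w"
  obtains i p where "i \<in> jumps" "w = of_int p - real i * \<alpha>"
proof -
  have "\<exists>i\<in>jumps. w + real i * \<alpha> \<in> \<int>"
  proof (rule ccontr)
    assume none: "\<not> (\<exists>i\<in>jumps. w + real i * \<alpha> \<in> \<int>)"
    \<comment> \<open>With \<open>\<epsilon>\<close> inserted, half the minimum is an admissible
      \<open>s\<close>, also when \<open>jumps\<close> is empty.\<close>
    define S where "S = insert \<epsilon> ((\<lambda>i. frac (w + real i * \<alpha>)) ` jumps)"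
    have fin: "finite S" "S \<noteq> {}" using finite_jumps by (auto simp: S_def)
    have "0 < Min S" using fin none assms(1) by (auto simp: S_def)
    moreover have "Min S \<le> \<epsilon>" using fin by (simp add: S_def)
    moreover have "F (w - Min S / 2) = F w"
    proof (rule no_jump)
      fix i assume "i \<in> jumps"
      then have "Min S \<le> frac (w + real i * \<alpha>)" using fin by (auto simp: S_def)
      then show "\<lfloor>w - Min S / 2 + real i * \<alpha>\<rfloor> = \<lfloor>w + real i * \<alpha>\<rfloor>"
        using \<open>0 < Min S\<close> unfolding frac_def by linarith
    qed (use \<open>0 < Min S\<close> in auto)
    ultimately show False using assms(2)[of "Min S / 2"] by simp
  qed
  then obtain i p where "i \<in> jumps" "w + real i * \<alpha> = of_int p" by (auto elim: Ints_cases)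
  then show thesis using that[of i p] by (simp add: algebra_simps)
qed

lemma no_translation_symmetry:
  assumes sym: "\<And>z. F (z + \<beta>) = F z" and ne: "jumps \<noteq> {}"
  shows "\<beta> \<in> \<int>"
proof -
  \<comment> \<open>translating by \<open>\<beta>\<close> and \<open>- \<beta>\<close> carries jump \<open>M\<close> to jumps \<open>i\<close> and \<open>i'\<close> with \<open>i + i' = 2 M\<close>, and maximality gives \<open>i = M\<close>\<close>
  define M where "M = Max jumps"
  have M: "M \<in> jumps" "\<And>i. i \<in> jumps \<Longrightarrow> i \<le> M" unfolding M_def using ne finite_jumps by (simp_all only: Max_in Max_ge not_False_eq_True)
  then have Mn: "M \<le> n" by (auto simp: jumps_def)
  \<comment> \<open>The jump is put as a discontinuity from the left because translations preserving
    \<open>F\<close> carry this form along.\<close>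
  have disc: "F (- (real M * \<alpha>) - s) \<noteq> F (- (real M * \<alpha>))" if "0 < s" "s < \<delta>" for s
    using jumps_iff[OF Mn, of "- (real M * \<alpha>)" 0 "- (real M * \<alpha>) - s" "- (real M * \<alpha>)"] that M(1) delta_pos by auto
  have "F (- (real M * \<alpha>) + \<beta> - s) \<noteq> F (- (real M * \<alpha>) + \<beta>)" if "0 < s" "s < \<delta>" for s
    using disc[OF that] sym[of "- (real M * \<alpha>) - s"] unfolding sym[of "- (real M * \<alpha>)"] by (simp add: add_diff_eq diff_add_eq)
  from left_discontinuity[OF delta_pos this]
  obtain i p where ip: "i \<in> jumps" "- (real M * \<alpha>) + \<beta> = of_int p - real i * \<alpha>" .
  have sym': "F (z - \<beta>) = F z" for z using sym[of "z - \<beta>"] by simp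
  have "F (- (real M * \<alpha>) - \<beta> - s) \<noteq> F (- (real M * \<alpha>) - \<beta>)" if "0 < s" "s < \<delta>" for s
    using disc[OF that] sym'[of "- (real M * \<alpha>) - s"] unfolding sym'[of "- (real M * \<alpha>)"] by (simp add: diff_diff_eq add.commute)
  from left_discontinuity[OF delta_pos this]
  obtain i' p' where ip': "i' \<in> jumps" "- (real M * \<alpha>) - \<beta> = of_int p' - real i' * \<alpha>" .
  have "(2 * real M - real i - real i') * \<alpha> = - of_int (p + p')"
    using ip(2) ip'(2) by (simp add: algebra_simps)
  then have "2 * real M - real i - real i' = 0"
  proof (rule contrapos_pp)
    assume nz: "2 * real M - real i - real i' \<noteq> 0"
    show "(2 * real M - real i - real i') * \<alpha> \<noteq> - of_int (p + p')"
    proof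
      assume eq: "(2 * real M - real i - real i') * \<alpha> = - of_int (p + p')"
      have "\<alpha> = (2 * real M - real i - real i') * \<alpha> / (2 * real M - real i - real i')" using nz by simp
      also have "\<dots> = - of_int (p + p') / (2 * real M - real i - real i')" unfolding eq ..
      also have "\<dots> \<in> \<rat>" by (intro Rats_divide Rats_diff Rats_mult Rats_minus_iff[THEN iffD2]) auto
      finally show False using irrational by simp
    qed
  qed
  then have "i = M" using M(2)[OF ip(1)] M(2)[OF ip'(1)] by linarith
  then have "\<beta> = of_int p" using ip(2) by simp
  then show ?thesis by simp
qed

text \<open>By contradiction: pairs that agree for \<open>K\<close> steps have differences
  accumulating at some \<open>\<beta>\<close> between \<open>\<delta>\<close> and
  \<open>1 - \<delta>\<close>. Uniform density takes every base point \<open>X K\<close> close to a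
  given \<open>z\<close> in bounded time, so \<open>\<beta>\<close> is a translation symmetry and
  hence an integer.\<close>

lemma far_points_separated:
  assumes ne: "jumps \<noteq> {}"
  obtains K where "\<And>x y. \<delta> \<le> y - x \<Longrightarrow> y - x \<le> 1 - \<delta> \<Longrightarrow>
    \<exists>j<K. F (x + real j * \<alpha>) \<noteq> F (y + real j * \<alpha>)"
proof (rule ccontr)
  assume "\<not> thesis"
  with that have "\<forall>K. \<exists>x y. \<delta> \<le> y - x \<and> y - x \<le> 1 - \<delta> \<and>
    (\<forall>j<K. F (x + real j * \<alpha>) = F (y + real j * \<alpha>))"
    by blast
  from choice[OF this] obtain X where "\<forall>K. \<exists>y. \<delta> \<le> y - X K \<and> y - X K \<le> 1 - \<delta> \<and>
    (\<forall>j<K. F (X K + real j * \<alpha>) = F (y + real j * \<alpha>))" ..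
  from choice[OF this] obtain Y where XY: "\<And>K. \<delta> \<le> Y K - X K" "\<And>K. Y K - X K \<le> 1 - \<delta>"
    "\<And>K j. j < K \<Longrightarrow> F (X K + real j * \<alpha>) = F (Y K + real j * \<alpha>)"
    by blast
  define D where "D K = Y K - X K" for K :: nat
  have "compact {\<delta>..1 - \<delta>}" by simp
  moreover have "\<forall>K. D K \<in> {\<delta>..1 - \<delta>}" using XY by (simp add: D_def)
  ultimately obtain \<beta> r where \<beta>: "\<beta> \<in> {\<delta>..1 - \<delta>}" and r: "strict_mono (r :: nat \<Rightarrow> nat)" and lim: "(D \<circ> r) \<longlonglongrightarrow> \<beta>"
    unfolding compact_def by meson
  have "F (z + \<beta>) = F z" for z
  proof -
    obtain \<epsilon>1 where \<epsilon>1: "0 < \<epsilon>1" "\<And>t. z \<le> t \<Longrightarrow> t < z + \<epsilon>1 \<Longrightarrow> F t = F z"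
      using right_continuous[of z] by blast
    obtain \<epsilon>2 where \<epsilon>2: "0 < \<epsilon>2" "\<And>t. z + \<beta> \<le> t \<Longrightarrow> t < z + \<beta> + \<epsilon>2 \<Longrightarrow> F t = F (z + \<beta>)"
      using right_continuous[of "z + \<beta>"] by blast
    \<comment> \<open>The orbit point of \<open>X\<close> will lie between
      \<open>z + \<epsilon>\<close> and \<open>z + 2 * \<epsilon>\<close>. The left margin absorbs
      the error in \<open>D\<close>, so the orbit point of \<open>Y\<close> stays to the right of
      \<open>z + \<beta>\<close> and within \<open>3 * \<epsilon>\<close> of it.\<close>
    define \<epsilon> where "\<epsilon> = min \<epsilon>1 \<epsilon>2 / 3"
    have \<epsilon>: "0 < \<epsilon>" "3 * \<epsilon> \<le> \<epsilon>1" "3 * \<epsilon> \<le> \<epsilon>2" using \<epsilon>1(1) \<epsilon>2(1) by (auto simp: \<epsilon>_def)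
    obtain N where N: "\<And>x z. \<exists>j<N. \<exists>p::int. z < x + real j * \<alpha> + of_int p \<and> x + real j * \<alpha> + of_int p < z + \<epsilon>"
      using orbit_uniformly_dense[OF irrational \<epsilon>(1)] by blast
    obtain k0 where "\<And>k. k \<ge> k0 \<Longrightarrow> \<bar>(D \<circ> r) k - \<beta>\<bar> < \<epsilon>"
      using lim \<epsilon>(1) unfolding LIMSEQ_iff real_norm_def by meson
    \<comment> \<open>Beyond \<open>k0\<close> the difference is close to \<open>\<beta>\<close>;
      beyond \<open>N\<close> the agreement covers all times \<open>j < N\<close>.\<close>
    define k where "k = max k0 N"
    have close: "\<bar>D (r k) - \<beta>\<bar> < \<epsilon>" using \<open>\<And>k. k \<ge> k0 \<Longrightarrow> \<bar>(D \<circ> r) k - \<beta>\<bar> < \<epsilon>\<close>[of k] by (simp add: k_def)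
    have "N \<le> r k" using seq_suble[OF r, of k] by (simp add: k_def)
    obtain j p where j: "j < N" "z + \<epsilon> < X (r k) + real j * \<alpha> + of_int p"
      "X (r k) + real j * \<alpha> + of_int p < z + \<epsilon> + \<epsilon>"
      using N[of "z + \<epsilon>" "X (r k)"] by blast
    have Y: "Y (r k) = X (r k) + D (r k)" by (simp add: D_def)
    have "F z = F (X (r k) + real j * \<alpha> + of_int p)"
      by (rule \<epsilon>1(2)[symmetric]) (use j \<epsilon> in linarith)+
    also have "\<dots> = F (X (r k) + real j * \<alpha>)" by (rule periodic_of_int)
    also have "\<dots> = F (Y (r k) + real j * \<alpha>)" using XY(3) j(1) \<open>N \<le> r k\<close> by simp
    also have "\<dots> = F (Y (r k) + real j * \<alpha> + of_int p)" by (rule periodic_of_int[symmetric])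
    also have "\<dots> = F (z + \<beta>)" by (rule \<epsilon>2(2)) (use close j \<epsilon> Y in linarith)+
    finally show ?thesis by simp
  qed
  then have "\<beta> \<in> \<int>" using no_translation_symmetry ne by blast
  then obtain p where "\<beta> = of_int p" by (rule Ints_cases)
  with \<beta> delta_pos have "0 < p" "p < 1" by auto
  then show False by simp
qed

text \<open>
  For \<open>x < y < x + 1\<close> the difference \<open>\<lfloor>y + i \<alpha>\<rfloor> - \<lfloor>x + i \<alpha>\<rfloor>\<close> is 1 if \<open>- i \<alpha>\<close> lies in \<open>(x, y]\<close> modulo 1,
  and 0 otherwise. Hence it is constant in \<open>i\<close> iff no two of the points \<open>- i \<alpha>\<close> separate \<open>x\<close> from
  \<open>y\<close> on the circle.
\<close>

lemma itinerary_iff: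
  assumes nonconst: "F a \<noteq> F b"
  obtains k l m where "1 \<le> k" "1 \<le> m" "l < n"
    "\<forall>x y. x < y \<longrightarrow> y < x + 1 \<longrightarrow>
      (\<forall>j<k. F (x + real j * \<alpha>) = F (y + real j * \<alpha>)) \<longleftrightarrow>
      (\<exists>c. \<forall>i\<in>{l..l + m}. \<lfloor>y + real i * \<alpha>\<rfloor> - \<lfloor>x + real i * \<alpha>\<rfloor> = c)"
proof -
  have ne: "jumps \<noteq> {}" using two_jumps[OF nonconst] by auto
  define l L where "l = Min jumps" and "L = Max jumps"
  have l: "l \<in> jumps" "\<And>i. i \<in> jumps \<Longrightarrow> l \<le> i" and L: "L \<in> jumps" "\<And>i. i \<in> jumps \<Longrightarrow> i \<le> L"
    unfolding l_def L_def using ne finite_jumps by (simp_all only: Min_in Min_le Max_in Max_ge not_False_eq_True)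
  have "l \<noteq> L"
  proof
    assume "l = L"
    then have "jumps \<subseteq> {l}" using l(2) L(2) by force
    then show False using two_jumps[OF nonconst] by blast
  qed
  then have "l < L" using l(2)[OF L(1)] by simp
  have "L \<le> n" using L(1) by (simp add: jumps_def)
  obtain K where K: "\<And>x y. \<delta> \<le> y - x \<Longrightarrow> y - x \<le> 1 - \<delta> \<Longrightarrow>
    \<exists>j<K. F (x + real j * \<alpha>) \<noteq> F (y + real j * \<alpha>)"
    using far_points_separated[OF ne] by blast
  \<comment> \<open>\<open>K\<close> handles distant points; \<open>k \<ge> L\<close> leaves no gap
    between the windows of length \<open>k\<close> starting at \<open>l\<close> and at
    \<open>L\<close>; \<open>l + m = L + k - 1\<close> is the largest sum of a jump and a time below
    \<open>k\<close>.\<close>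
  define k m where "k = max K L" and "m = L - l + k - 1"
  have k: "K \<le> k" "L \<le> k" by (auto simp: k_def)
  have lm: "l + m = L + k - 1" using \<open>l < L\<close> by (simp add: m_def)
  show thesis
  proof (rule that[of k m l])
    show "1 \<le> k" "1 \<le> m" "l < n" using k \<open>l < L\<close> \<open>L \<le> n\<close> by (auto simp: m_def)
    have F1: "F (z + 1 + real j * \<alpha>) = F (z + real j * \<alpha>)" for z j
      using periodic[of "z + real j * \<alpha>"] by (simp add: algebra_simps)
    \<comment> \<open>Jump \<open>i\<close> met at time \<open>j\<close> corresponds to the floor of
      index \<open>i + j\<close> at time 0.\<close>
    have same: "\<forall>j<k. F (x + real j * \<alpha>) = F (y + real j * \<alpha>)"
      if "x < y" and eq: "\<And>i. i \<in> {l..l + m} \<Longrightarrow> \<lfloor>y + real i * \<alpha>\<rfloor> = \<lfloor>x + real i * \<alpha>\<rfloor>" for x y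
    proof (intro allI impI no_jump)
      fix j i assume "j < k" "i \<in> jumps"
      then have "i + j \<in> {l..l + m}" using l(2)[of i] L(2)[of i] lm by auto
      from eq[OF this] show "\<lfloor>x + real j * \<alpha> + real i * \<alpha>\<rfloor> = \<lfloor>y + real j * \<alpha> + real i * \<alpha>\<rfloor>"
        by (simp add: algebra_simps)
    qed (use that in auto)
    have diff: "\<exists>j<k. F (x + real j * \<alpha>) \<noteq> F (y + real j * \<alpha>)"
      if "x < y" "y - x < \<delta>" "i \<in> {l..l + m}" "\<lfloor>y + real i * \<alpha>\<rfloor> \<noteq> \<lfloor>x + real i * \<alpha>\<rfloor>" for x y i
    proof -
      \<comment> \<open>After \<open>i - s\<close> rotations \<open>- i * \<alpha>\<close> lands on
        the jump \<open>- s * \<alpha>\<close>; one of the two extreme jumps is reached in fewer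
        than \<open>k\<close> steps.\<close>
      define s where "s = (if i < l + k then l else L)"
      have s: "s \<in> jumps" "s \<le> i" "i - s < k" using l(1) L(1) that(3) k \<open>l < L\<close> lm by (auto simp: s_def)
      have "\<lfloor>x + real (i - s) * \<alpha> + real s * \<alpha>\<rfloor> \<noteq> \<lfloor>y + real (i - s) * \<alpha> + real s * \<alpha>\<rfloor>"
        using that(4) s(2) by (simp add: of_nat_diff algebra_simps)
      from jump_separates[OF s(1) this] that(1,2) s(3) show ?thesis by auto
    qed
    show "\<forall>x y. x < y \<longrightarrow> y < x + 1 \<longrightarrow>
      (\<forall>j<k. F (x + real j * \<alpha>) = F (y + real j * \<alpha>)) \<longleftrightarrow>
      (\<exists>c. \<forall>i\<in>{l..l + m}. \<lfloor>y + real i * \<alpha>\<rfloor> - \<lfloor>x + real i * \<alpha>\<rfloor> = c)"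
    proof (intro allI impI)
      fix x y :: real assume xy: "x < y" "y < x + 1"
      define d where "d i = \<lfloor>y + real i * \<alpha>\<rfloor> - \<lfloor>x + real i * \<alpha>\<rfloor>" for i
      have d01: "d i = 0 \<or> d i = 1" for i unfolding d_def using xy by linarith
      have fl1: "\<lfloor>x + 1 + real i * \<alpha>\<rfloor> = \<lfloor>x + real i * \<alpha>\<rfloor> + 1" for i by linarith
      have "(\<forall>j<k. F (x + real j * \<alpha>) = F (y + real j * \<alpha>)) \<longleftrightarrow> (\<exists>c. \<forall>i\<in>{l..l + m}. d i = c)"
      proof
        assume eqF: "\<forall>j<k. F (x + real j * \<alpha>) = F (y + real j * \<alpha>)"
        show "\<exists>c. \<forall>i\<in>{l..l + m}. d i = c"
        proof (rule ccontr)
          assume "\<not> ?thesis"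
          then obtain i i' where i: "i \<in> {l..l + m}" "d i \<noteq> 0" and i': "i' \<in> {l..l + m}" "d i' \<noteq> 1"
            by blast
          \<comment> \<open>Either arc between the points may be the short one. A short arc from
            \<open>x\<close> to \<open>y\<close> contains the point with \<open>d i = 1\<close>; a
            short arc from \<open>y\<close> to \<open>x + 1\<close> contains the point with
            \<open>d i' = 0\<close>.\<close>
          consider "y - x < \<delta>" | "x + 1 - y < \<delta>" | "\<delta> \<le> y - x" "y - x \<le> 1 - \<delta>" by linarith
          then show False
          proof cases
            case 1
            then show False using diff[of x y i] xy i eqF by (auto simp: d_def)
          next
            case 2
            have "\<lfloor>x + 1 + real i' * \<alpha>\<rfloor> \<noteq> \<lfloor>y + real i' * \<alpha>\<rfloor>" using i'(2) fl1[of i'] by (simp add: d_def)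
            then show False using diff[of y "x + 1" i'] xy 2 i' eqF F1 by auto
          next
            case 3
            then obtain j where "j < K" "F (x + real j * \<alpha>) \<noteq> F (y + real j * \<alpha>)" using K by blast
            then show False using eqF k by auto
          qed
        qed
      next
        assume "\<exists>c. \<forall>i\<in>{l..l + m}. d i = c"
        then obtain c where c: "\<And>i. i \<in> {l..l + m} \<Longrightarrow> d i = c" by blast
        have "d l = c" using c by simp
        then consider "c = 0" | "c = 1" using d01[of l] by auto
        then show "\<forall>j<k. F (x + real j * \<alpha>) = F (y + real j * \<alpha>)"
        proof cases
          case 1
          then show ?thesis using same[of x y] xy c by (auto simp: d_def)
        next
          case 2
          \<comment> \<open>Every point lies in \<open>(x, y]\<close> modulo 1, hence none in
            \<open>(y, x + 1]\<close>: go round the other way.\<close>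
          have "\<lfloor>x + 1 + real i * \<alpha>\<rfloor> = \<lfloor>y + real i * \<alpha>\<rfloor>" if "i \<in> {l..l + m}" for i
            using c[OF that] 2 fl1[of i] by (simp add: d_def)
          then show ?thesis using same[of y "x + 1"] xy F1 by auto
        qed
      qed
      then show "(\<forall>j<k. F (x + real j * \<alpha>) = F (y + real j * \<alpha>)) \<longleftrightarrow>
        (\<exists>c. \<forall>i\<in>{l..l + m}. \<lfloor>y + real i * \<alpha>\<rfloor> - \<lfloor>x + real i * \<alpha>\<rfloor> = c)"
        unfolding d_def .
    qed
  qed
qed

end

section \<open>Refinements as itinerary classes\<close>

text \<open>For a partition this is the singleton of the atom of \<open>frac x\<close>. The set form
  avoids a choice and makes the colouring a function of period 1 on the reals.\<close>

definition coding :: "real set set \<Rightarrow> real \<Rightarrow> real set set" where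
  "coding \<R> x = {A \<in> \<R>. frac x \<in> A}"

text \<open>The times form an arbitrary set, so that \<open>{l..<l + m}\<close> can express pulling
  back by \<open>l\<close>.\<close>

definition cells :: "real \<Rightarrow> real set set \<Rightarrow> nat set \<Rightarrow> real set set" where
  "cells \<alpha> \<R> J =
    (\<lambda>x. {y \<in> circle. \<forall>j\<in>J. coding \<R> (y + real j * \<alpha>) = coding \<R> (x + real j * \<alpha>)}) ` circle"

lemma frac_in_circle [simp]: "frac x \<in> circle"
  by (simp add: circle_def frac_lt_1)

lemma frac_circle: "x \<in> circle \<Longrightarrow> frac x = x"
  by (simp add: circle_def frac_eq)

lemma coding_cong: "frac x = frac y \<Longrightarrow> coding \<R> x = coding \<R> y"
  by (simp add: coding_def)

lemma coding_frac: "coding \<R> (frac x + a) = coding \<R> (x + a)"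
  by (rule coding_cong) simp

lemma coding_eq_iff:
  assumes "partition_on circle \<R>" "A \<in> \<R>" "frac x \<in> A"
  shows "coding \<R> y = coding \<R> x \<longleftrightarrow> frac y \<in> A"
proof
  assume "coding \<R> y = coding \<R> x"
  then show "frac y \<in> A" using assms(2,3) by (auto simp: coding_def)
next
  assume "frac y \<in> A"
  then show "coding \<R> y = coding \<R> x"
    using assms partition_onD2[OF assms(1)] by (auto simp: coding_def disjoint_def)
qed

lemma coding_atom:
  assumes "partition_on circle \<R>"
  obtains A where "A \<in> \<R>" "frac x \<in> A"
proof -
  have "frac x \<in> \<Union>\<R>" unfolding partition_onD1[OF assms, symmetric] by simp
  then show thesis using that by blast
qed

lemma rot_funpow: "x \<in> circle \<Longrightarrow> (rot \<alpha> ^^ j) x = frac (x + real j * \<alpha>)"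
proof (induction j)
  case 0
  then show ?case by (simp add: frac_circle)
next
  case (Suc j)
  then show ?case by (simp add: rot_def algebra_simps)
qed

lemma mem_rot_preimage: "y \<in> rot_preimage \<alpha> j A \<longleftrightarrow> y \<in> circle \<and> frac (y + real j * \<alpha>) \<in> A"
  by (auto simp: rot_preimage_def rot_funpow)

text \<open>A non-empty intersection is the itinerary class of any of its points; conversely, the
  itinerary of \<open>x\<close> supplies the atoms for its class.\<close>

lemma refinement_eq_cells:
  assumes R: "partition_on circle \<R>" and "1 \<le> k"
  shows "refinement \<alpha> k \<R> = cells \<alpha> \<R> {..<k}"
proof (intro set_eqI iffI)
  \<comment> \<open>Time 0 confines the intersection to the circle; over no times it would be all of
    the reals.\<close>
  have k: "0 \<in> {..<k}" using assms(2) by simp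
  fix X assume "X \<in> refinement \<alpha> k \<R>"
  then obtain A x where X: "X = (\<Inter>j<k. rot_preimage \<alpha> j (A j))" and A: "\<And>j. j < k \<Longrightarrow> A j \<in> \<R>" and x: "x \<in> X"
    unfolding refinement_def by blast
  have memX: "y \<in> X \<longleftrightarrow> y \<in> circle \<and> (\<forall>j\<in>{..<k}. frac (y + real j * \<alpha>) \<in> A j)" for y
    unfolding X INT_iff mem_rot_preimage using k by blast
  have "X = {y \<in> circle. \<forall>j\<in>{..<k}. coding \<R> (y + real j * \<alpha>) = coding \<R> (x + real j * \<alpha>)}"
    using memX x coding_eq_iff[OF R A] by auto
  then show "X \<in> cells \<alpha> \<R> {..<k}" using memX x unfolding cells_def by blast
next
  have k: "0 \<in> {..<k}" using assms(2) by simp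
  fix X assume "X \<in> cells \<alpha> \<R> {..<k}"
  then obtain x where x: "x \<in> circle"
    "X = {y \<in> circle. \<forall>j\<in>{..<k}. coding \<R> (y + real j * \<alpha>) = coding \<R> (x + real j * \<alpha>)}"
    unfolding cells_def by blast
  have "\<forall>j. \<exists>A. A \<in> \<R> \<and> frac (x + real j * \<alpha>) \<in> A" using coding_atom[OF R] by blast
  from choice[OF this] obtain A where A: "\<And>j. A j \<in> \<R>" "\<And>j. frac (x + real j * \<alpha>) \<in> A j" by blast
  have "X = (\<Inter>j<k. rot_preimage \<alpha> j (A j))"
    unfolding x(2) coding_eq_iff[OF R A] using k by (intro set_eqI) (simp only: INT_iff mem_rot_preimage mem_Collect_eq, blast)
  moreover have "x \<in> X" using x by simp
  ultimately show "X \<in> refinement \<alpha> k \<R>" using A(1) unfolding refinement_def by blast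
qed

text \<open>Rotating \<open>l\<close> times shifts the times by \<open>l\<close>; since the rotation
  is onto, every class has a rotated point as representative.\<close>

lemma pull_partition_cells:
  "pull_partition \<alpha> l (cells \<alpha> \<R> {..<m}) = cells \<alpha> \<R> {l..<l + m}"
proof -
  define C where "C J x = {y \<in> circle. \<forall>j\<in>J. coding \<R> (y + real j * \<alpha>) = coding \<R> (x + real j * \<alpha>)}"
    for J :: "nat set" and x
  have cells: "cells \<alpha> \<R> J = C J ` circle" for J by (simp add: cells_def C_def)
  have shift: "rot_preimage \<alpha> l (C {..<m} (frac (x + real l * \<alpha>))) = C {l..<l + m} x" for x
  proof -
    have cod: "coding \<R> (frac (z + real l * \<alpha>) + real j * \<alpha>) = coding \<R> (z + real (l + j) * \<alpha>)" for z j
      unfolding coding_frac by (simp add: algebra_simps)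
    have im: "{l..<l + m} = (+) l ` {..<m}" using image_add_atLeastLessThan[of l 0 m]
      by (simp add: lessThan_atLeast0 add.commute)
    show ?thesis unfolding C_def im by (auto simp: mem_rot_preimage cod)
  qed
  have "pull_partition \<alpha> l (cells \<alpha> \<R> {..<m}) = (\<lambda>x. rot_preimage \<alpha> l (C {..<m} x)) ` circle"
    by (simp add: pull_partition_def cells image_image)
  also have "circle = (\<lambda>x. frac (x + real l * \<alpha>)) ` circle"
  proof (intro set_eqI iffI)
    fix z assume z: "z \<in> circle"
    have "frac (frac (z - real l * \<alpha>) + real l * \<alpha>) = z" using frac_circle[OF z] by simp
    then show "z \<in> (\<lambda>x. frac (x + real l * \<alpha>)) ` circle"
      by (intro image_eqI[of _ _ "frac (z - real l * \<alpha>)"]) simp_all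
  qed auto
  also have "(\<lambda>x. rot_preimage \<alpha> l (C {..<m} x)) ` (\<lambda>x. frac (x + real l * \<alpha>)) ` circle = C {l..<l + m} ` circle"
    by (simp add: image_image shift)
  finally show ?thesis by (simp add: cells)
qed

lemma partition_on_pull_partition:
  assumes R: "partition_on circle \<R>"
  shows "partition_on circle (pull_partition \<alpha> l \<R>)"
proof (rule partition_onI)
  show "\<Union> (pull_partition \<alpha> l \<R>) = circle"
  proof -
    have "\<exists>A\<in>\<R>. frac z \<in> A" for z using coding_atom[OF R, of z] by blast
    then show ?thesis by (auto simp: pull_partition_def mem_rot_preimage)
  qed
  show "{} \<notin> pull_partition \<alpha> l \<R>"
  proof
    assume "{} \<in> pull_partition \<alpha> l \<R>"
    then obtain A where A: "A \<in> \<R>" "rot_preimage \<alpha> l A = {}" by (auto simp: pull_partition_def)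
    obtain z where z: "z \<in> A" using A(1) partition_onD3[OF R] by (metis ex_in_conv)
    then have "z \<in> circle" using partition_onD1[OF R] A(1) by blast
    then have "frac (z - real l * \<alpha>) \<in> rot_preimage \<alpha> l A"
      using z by (simp add: mem_rot_preimage frac_circle)
    then show False using A(2) by simp
  qed
  fix p q assume "p \<in> pull_partition \<alpha> l \<R>" "q \<in> pull_partition \<alpha> l \<R>" "p \<noteq> q"
  then obtain A B where AB: "A \<in> \<R>" "B \<in> \<R>" "p = rot_preimage \<alpha> l A" "q = rot_preimage \<alpha> l B" "A \<noteq> B"
    unfolding pull_partition_def by blast
  then have "A \<inter> B = {}" using partition_onD2[OF R] by (simp add: disjoint_def)
  then show "disjnt p q" unfolding AB(3,4) disjnt_iff mem_rot_preimage by blast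
qed

text \<open>Each coding is computed from the other by a fixed rule: one way as an image under
  \<open>rot_preimage\<close>, back by membership.\<close>

lemma coding_pull_partition_eq_iff:
  "coding (pull_partition \<alpha> l \<R>) x = coding (pull_partition \<alpha> l \<R>) y \<longleftrightarrow>
    coding \<R> (x + real l * \<alpha>) = coding \<R> (y + real l * \<alpha>)"
proof -
  have "coding (pull_partition \<alpha> l \<R>) z = rot_preimage \<alpha> l ` coding \<R> (z + real l * \<alpha>)" for z
    by (auto simp: coding_def pull_partition_def mem_rot_preimage)
  moreover have "coding \<R> (z + real l * \<alpha>) = {A \<in> \<R>. rot_preimage \<alpha> l A \<in> coding (pull_partition \<alpha> l \<R>) z}" for z
    by (auto simp: coding_def pull_partition_def mem_rot_preimage)
  ultimately show ?thesis by metis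
qed

lemma cells_pull_partition:
  "cells \<alpha> (pull_partition \<alpha> l \<R>) {..<m} = cells \<alpha> \<R> {l..<l + m}"
proof -
  have im: "{l..<l + m} = (+) l ` {..<m}" using image_add_atLeastLessThan[of l 0 m]
    by (simp add: lessThan_atLeast0 add.commute)
  show ?thesis unfolding cells_def im coding_pull_partition_eq_iff by (simp add: algebra_simps)
qed

lemma pull_refinement_eq_cells:
  assumes "partition_on circle \<R>" "1 \<le> m"
  shows "pull_partition \<alpha> l (refinement \<alpha> m \<R>) = cells \<alpha> \<R> {l..<l + m}"
  by (simp add: refinement_eq_cells[OF assms] pull_partition_cells)

lemma refinement_pull_eq_cells:
  assumes "partition_on circle \<R>" "1 \<le> m"
  shows "refinement \<alpha> m (pull_partition \<alpha> l \<R>) = cells \<alpha> \<R> {l..<l + m}"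
  by (simp add: refinement_eq_cells[OF partition_on_pull_partition[OF assms(1)] assms(2)] cells_pull_partition)

section \<open>Carries: the coding of the two-interval partition\<close>

lemma partition_on_rot_partition:
  assumes "0 < \<alpha>" "\<alpha> < 1"
  shows "partition_on circle (rot_partition \<alpha>)"
  using assms by (intro partition_onI) (auto simp: rot_partition_def circle_def disjnt_iff)

text \<open>The letter of \<open>x\<close> is the carry that occurs when \<open>\<alpha>\<close> is
  added; written with floors, it telescopes along orbits.\<close>

lemma coding_rot_partition_eq_iff:
  assumes "0 < \<alpha>" "\<alpha> < 1"
  shows "coding (rot_partition \<alpha>) x = coding (rot_partition \<alpha>) y \<longleftrightarrow>
    \<lfloor>x + \<alpha>\<rfloor> - \<lfloor>x\<rfloor> = \<lfloor>y + \<alpha>\<rfloor> - \<lfloor>y\<rfloor>"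
proof -
  note P = partition_on_rot_partition[OF assms]
  have fl: "\<lfloor>z + \<alpha>\<rfloor> - \<lfloor>z\<rfloor> = (if frac z < 1 - \<alpha> then 0 else 1)" for z
    using assms unfolding frac_def by (auto; linarith)
  show ?thesis
  proof (cases "frac y < 1 - \<alpha>")
    case True
    then have "coding (rot_partition \<alpha>) x = coding (rot_partition \<alpha>) y \<longleftrightarrow> frac x \<in> {0..<1 - \<alpha>}"
      by (intro coding_eq_iff[OF P]) (auto simp: rot_partition_def)
    then show ?thesis using True by (auto simp: fl)
  next
    case False
    then have "coding (rot_partition \<alpha>) x = coding (rot_partition \<alpha>) y \<longleftrightarrow> frac x \<in> {1 - \<alpha>..<1}"
      by (intro coding_eq_iff[OF P]) (auto simp: rot_partition_def frac_lt_1)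
    then show ?thesis using False by (auto simp: fl frac_lt_1)
  qed
qed

lemma rot_partition_itinerary_iff:
  assumes "0 < \<alpha>" "\<alpha> < 1"
  shows "(\<forall>j\<in>{l..<l + m}. coding (rot_partition \<alpha>) (y + real j * \<alpha>) = coding (rot_partition \<alpha>) (x + real j * \<alpha>)) \<longleftrightarrow>
    (\<exists>c. \<forall>i\<in>{l..l + m}. \<lfloor>y + real i * \<alpha>\<rfloor> - \<lfloor>x + real i * \<alpha>\<rfloor> = c)"
proof -
  define d where "d i = \<lfloor>y + real i * \<alpha>\<rfloor> - \<lfloor>x + real i * \<alpha>\<rfloor>" for i
  \<comment> \<open>the floor of z + alpha exceeds that of z exactly when z lies in the second interval, so a letter compares two consecutive values of d\<close>
  have step: "coding (rot_partition \<alpha>) (y + real j * \<alpha>) = coding (rot_partition \<alpha>) (x + real j * \<alpha>) \<longleftrightarrow> d (Suc j) = d j" for j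
  proof -
    have "z + real j * \<alpha> + \<alpha> = z + real (Suc j) * \<alpha>" for z by (simp add: algebra_simps)
    then show ?thesis unfolding coding_rot_partition_eq_iff[OF assms] d_def by (simp only:) linarith
  qed
  \<comment> \<open>\<open>m\<close> letters link \<open>m + 1\<close> consecutive values of
    \<open>d\<close>, hence the closed index range up to \<open>l + m\<close>.\<close>
  have "(\<forall>j\<in>{l..<l + m}. d (Suc j) = d j) \<longleftrightarrow> (\<exists>c. \<forall>i\<in>{l..l + m}. d i = c)"
  proof
    assume *: "\<forall>j\<in>{l..<l + m}. d (Suc j) = d j"
    have "d (l + t) = d l" if "t \<le> m" for t
      using that by (induction t) (use * in auto)
    then have "\<forall>i\<in>{l..l + m}. d i = d l" by (metis atLeastAtMost_iff le_Suc_ex nat_add_left_cancel_le)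
    then show "\<exists>c. \<forall>i\<in>{l..l + m}. d i = c" by blast
  next
    assume "\<exists>c. \<forall>i\<in>{l..l + m}. d i = c"
    then obtain c where "\<And>i. i \<in> {l..l + m} \<Longrightarrow> d i = c" by blast
    then show "\<forall>j\<in>{l..<l + m}. d (Suc j) = d j" by simp
  qed
  then show ?thesis unfolding step d_def .
qed

section \<open>Arcs between finitely many points\<close>

text \<open>The difference of indicators records which points of \<open>E\<close> are passed between
  \<open>x\<close> and \<open>y\<close>; it is constant when none or all of them are. The clause
  \<open>a = x\<close> makes each point of \<open>E\<close> the left end of its own class.\<close>

lemma cyclic_class_eq_arc:
  fixes E :: "real set"
  assumes E: "E \<subseteq> circle" "finite E" "e1 \<in> E" "e2 \<in> E" "e1 \<noteq> e2" and x: "x \<in> circle"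
  obtains a b where "a \<in> E" "b \<in> E" "a \<noteq> b" "x \<in> E \<longrightarrow> a = x"
    "{y \<in> circle. \<exists>c::int. \<forall>e\<in>E. of_bool (e \<le> y) - of_bool (e \<le> x) = c} = Defs.arc a b"
proof -
  define L U where "L = {e \<in> E. e \<le> x}" and "U = {e \<in> E. x < e}"
  define C where "C = {y \<in> circle. \<exists>c::int. \<forall>e\<in>E. of_bool (e \<le> y) - of_bool (e \<le> x) = c}"
  \<comment> \<open>Evaluating at \<open>e1\<close> limits the constant to 0, 1 and -1: no point of
    \<open>E\<close> is passed, or all going right, or all going left. In the last two cases the way
    round through 0 avoids \<open>E\<close>.\<close>
  have memC: "y \<in> C \<longleftrightarrow> y \<in> circle \<and>
    ((\<forall>e\<in>E. e \<le> y \<longleftrightarrow> e \<le> x) \<or> (\<forall>e\<in>E. x < e \<and> e \<le> y) \<or> (\<forall>e\<in>E. e \<le> x \<and> y < e))" for y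
  proof -
    have "(\<exists>c::int. \<forall>e\<in>E. of_bool (e \<le> y) - of_bool (e \<le> x) = c) \<longleftrightarrow>
      (\<forall>e\<in>E. of_bool (e \<le> y) - of_bool (e \<le> x) = (0::int)) \<or>
      (\<forall>e\<in>E. of_bool (e \<le> y) - of_bool (e \<le> x) = (1::int)) \<or>
      (\<forall>e\<in>E. of_bool (e \<le> y) - of_bool (e \<le> x) = (-1::int))" (is "?l \<longleftrightarrow> ?r")
    proof
      assume ?l
      then obtain c :: int where c: "\<forall>e\<in>E. of_bool (e \<le> y) - of_bool (e \<le> x) = c" by blast
      then have "c = of_bool (e1 \<le> y) - of_bool (e1 \<le> x)" using E(3) by simp
      then have "c = 0 \<or> c = 1 \<or> c = -1" by (auto simp: of_bool_def split: if_splits)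
      then show ?r using c by blast
    qed blast
    note ex_iff = this
    have ob: "of_bool p - of_bool q = (0::int) \<longleftrightarrow> p = q"
      "of_bool p - of_bool q = (1::int) \<longleftrightarrow> p \<and> \<not> q"
      "of_bool p - of_bool q = (-1::int) \<longleftrightarrow> q \<and> \<not> p" for p q
      by (auto simp: of_bool_def)
    show ?thesis unfolding C_def mem_Collect_eq ex_iff ob not_le by blast
  qed
  have fin: "finite L" "finite U" using E(2) by (auto simp: L_def U_def)
  show thesis
  proof (cases "L \<noteq> {} \<and> U \<noteq> {}")
    case True
    define a b where "a = Max L" and "b = Min U"
    have a: "a \<in> L" "\<And>e. e \<in> L \<Longrightarrow> e \<le> a" unfolding a_def using fin True by auto
    have b: "b \<in> U" "\<And>e. e \<in> U \<Longrightarrow> b \<le> e" unfolding b_def using fin True by auto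
    have ab: "a \<in> E" "a \<le> x" "b \<in> E" "x < b" using a(1) b(1) by (auto simp: L_def U_def)
    have circ: "0 \<le> a" "b < 1" using ab E(1) by (auto simp: circle_def)
    have cl: "y \<in> C \<longleftrightarrow> a \<le> y \<and> y < b" for y
    proof
      assume "y \<in> C"
      then have "a \<le> y \<longleftrightarrow> a \<le> x" "b \<le> y \<longleftrightarrow> b \<le> x" using memC ab by force+
      then show "a \<le> y \<and> y < b" using ab by auto
    next
      assume y: "a \<le> y \<and> y < b"
      have "e \<le> y \<longleftrightarrow> e \<le> x" if "e \<in> E" for e
        using a(2)[of e] b(2)[of e] y ab that unfolding L_def U_def by force
      then show "y \<in> C" using y circ memC by (auto simp: circle_def)
    qed
    show thesis
    proof (rule that)
      show "a \<in> E" "b \<in> E" "a \<noteq> b" using ab by auto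
      show "x \<in> E \<longrightarrow> a = x" using a(2)[of x] ab by (auto simp: L_def)
      show "{y \<in> circle. \<exists>c::int. \<forall>e\<in>E. of_bool (e \<le> y) - of_bool (e \<le> x) = c} = Defs.arc a b"
        unfolding C_def[symmetric] Defs.arc_def using ab by (auto simp: set_eq_iff cl)
    qed
  next
    case False
    \<comment> \<open>Either all of \<open>E\<close> lies to the right of \<open>x\<close> or none
      of it does, so the class runs from the last point of \<open>E\<close> round to the
      first.\<close>
    define a b where "a = Max E" and "b = Min E"
    have "E \<noteq> {}" using E(3) by blast
    then have a: "a \<in> E" "\<And>e. e \<in> E \<Longrightarrow> e \<le> a" and b: "b \<in> E" "\<And>e. e \<in> E \<Longrightarrow> b \<le> e"
      unfolding a_def b_def using E(2) by (simp_all only: Min_in Min_le Max_in Max_ge not_False_eq_True)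
    have "b < a" using a(2)[OF E(3)] a(2)[OF E(4)] b(2)[OF E(3)] b(2)[OF E(4)] E(5) by linarith
    have circ: "0 \<le> a" "a < 1" "0 \<le> b" "b < 1" using a b E(1) by (auto simp: circle_def)
    have alt: "(\<forall>e\<in>E. x < e) \<or> (\<forall>e\<in>E. e \<le> x)" using False by (auto simp: L_def U_def not_le)
    have cl: "y \<in> C \<longleftrightarrow> y \<in> circle \<and> (y < b \<or> a \<le> y)" for y
    proof -
      have ext: "(\<forall>e\<in>E. y < e) \<longleftrightarrow> y < b" "(\<forall>e\<in>E. e \<le> y) \<longleftrightarrow> a \<le> y"
        using a b by force+
      from alt show ?thesis
      proof
        assume *: "\<forall>e\<in>E. x < e"
        have "(\<forall>e\<in>E. e \<le> y \<longleftrightarrow> e \<le> x) \<longleftrightarrow> (\<forall>e\<in>E. y < e)"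
          by (intro ball_cong refl) (use * in force)
        moreover have "(\<forall>e\<in>E. x < e \<and> e \<le> y) \<longleftrightarrow> (\<forall>e\<in>E. e \<le> y)" using * by blast
        moreover have "\<not> (\<forall>e\<in>E. e \<le> x \<and> y < e)" using * a(1) by force
        ultimately show ?thesis unfolding memC ext by blast
      next
        assume *: "\<forall>e\<in>E. e \<le> x"
        have "(\<forall>e\<in>E. e \<le> y \<longleftrightarrow> e \<le> x) \<longleftrightarrow> (\<forall>e\<in>E. e \<le> y)"
          by (intro ball_cong refl) (use * in force)
        moreover have "(\<forall>e\<in>E. e \<le> x \<and> y < e) \<longleftrightarrow> (\<forall>e\<in>E. y < e)" using * by blast
        moreover have "\<not> (\<forall>e\<in>E. x < e \<and> e \<le> y)" using * a(1) by force
        ultimately show ?thesis unfolding memC ext by blast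
      qed
    qed
    show thesis
    proof (rule that)
      show "a \<in> E" "b \<in> E" "a \<noteq> b" using a b \<open>b < a\<close> by auto
      show "x \<in> E \<longrightarrow> a = x" using alt a by force
      show "{y \<in> circle. \<exists>c::int. \<forall>e\<in>E. of_bool (e \<le> y) - of_bool (e \<le> x) = c} = Defs.arc a b"
      proof -
        have "C = {a..<1} \<union> {0..<b}" by (rule set_eqI) (use circ in \<open>auto simp: cl circle_def\<close>)
        then show ?thesis unfolding C_def[symmetric] Defs.arc_def using \<open>b < a\<close> by simp
      qed
    qed
  qed
qed

text \<open>The constants add up, so classes that share a point coincide; each endpoint is accounted
  for by the class that starts there.\<close>

lemma interval_partition_cyclic_classes:
  fixes E :: "real set"
  assumes E: "E \<subseteq> circle" "finite E" "e1 \<in> E" "e2 \<in> E" "e1 \<noteq> e2"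
  shows "interval_partition E
    ((\<lambda>x. {y \<in> circle. \<exists>c::int. \<forall>e\<in>E. of_bool (e \<le> y) - of_bool (e \<le> x) = c}) ` circle)"
proof -
  define C where "C x = {y \<in> circle. \<exists>c::int. \<forall>e\<in>E. of_bool (e \<le> y) - of_bool (e \<le> x) = c}" for x
  have self: "x \<in> C x" if "x \<in> circle" for x using that by (simp add: C_def)
  have sub: "C x \<subseteq> C y" if zx: "z \<in> C x" and zy: "z \<in> C y" for x y z
  proof
    fix w assume w: "w \<in> C x"
    obtain c1 :: int where c1: "\<forall>e\<in>E. of_bool (e \<le> z) - of_bool (e \<le> x) = c1" using zx unfolding C_def by blast
    obtain c2 :: int where c2: "\<forall>e\<in>E. of_bool (e \<le> z) - of_bool (e \<le> y) = c2" using zy unfolding C_def by blast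
    obtain c3 :: int where c3: "\<forall>e\<in>E. of_bool (e \<le> w) - of_bool (e \<le> x) = c3" using w unfolding C_def by blast
    have "of_bool (e \<le> w) - of_bool (e \<le> y) = c3 - c1 + c2" if "e \<in> E" for e
      using c1[rule_format, OF that] c2[rule_format, OF that] c3[rule_format, OF that] by linarith
    then show "w \<in> C y" using w unfolding C_def by blast
  qed
  have arc: "\<exists>a\<in>E. \<exists>b\<in>E. a \<noteq> b \<and> (x \<in> E \<longrightarrow> a = x) \<and> C x = Defs.arc a b" if x: "x \<in> circle" for x
  proof -
    obtain a b where "a \<in> E" "b \<in> E" "a \<noteq> b" "x \<in> E \<longrightarrow> a = x" "C x = Defs.arc a b"
      unfolding C_def by (rule cyclic_class_eq_arc[OF E x])
    then show ?thesis by blast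
  qed
  have "interval_partition E (C ` circle)"
    unfolding interval_partition_def
  proof (intro conjI)
    show "E \<subseteq> circle" by fact
    show "partition_on circle (C ` circle)"
    proof (rule partition_onI)
      show "\<Union> (C ` circle) = circle" using self by (auto simp: C_def)
      show "{} \<notin> C ` circle" using self by auto
      fix p q assume "p \<in> C ` circle" "q \<in> C ` circle" "p \<noteq> q"
      then show "disjnt p q" using sub unfolding disjnt_iff by blast
    qed
    show "\<forall>I\<in>C ` circle. \<exists>a\<in>E. \<exists>b\<in>E. a \<noteq> b \<and> I = Defs.arc a b" using arc by blast
    show "\<forall>e\<in>E. \<exists>a\<in>E. a \<noteq> e \<and> (Defs.arc a e \<in> C ` circle \<or> Defs.arc e a \<in> C ` circle)"
    proof
      fix e assume "e \<in> E"
      then have "e \<in> circle" using E(1) by blast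
      with arc \<open>e \<in> E\<close> obtain b where "b \<in> E" "e \<noteq> b" "C e = Defs.arc e b" by blast
      then have "Defs.arc e b \<in> C ` circle" using \<open>e \<in> circle\<close> by (metis imageI)
      then show "\<exists>a\<in>E. a \<noteq> e \<and> (Defs.arc a e \<in> C ` circle \<or> Defs.arc e a \<in> C ` circle)"
        using \<open>b \<in> E\<close> \<open>e \<noteq> b\<close> by (intro bexI[of _ b] conjI disjI2) simp_all
    qed
  qed
  then show ?thesis unfolding C_def .
qed

text \<open>On the fundamental domain the floor of \<open>y + i * \<alpha>\<close> is the indicator
  of \<open>e i \<le> y\<close> plus a term free of \<open>y\<close>, which cancels in
  differences.\<close>

lemma orbit_interval_partition:
  assumes irr: "\<alpha> \<notin> \<rat>" and "1 \<le> m"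
  shows "interval_partition (\<Union>i\<in>{l..l + m}. rot_preimage \<alpha> i {0})
    ((\<lambda>x. {y \<in> circle. \<exists>c. \<forall>i\<in>{l..l + m}. \<lfloor>y + real i * \<alpha>\<rfloor> - \<lfloor>x + real i * \<alpha>\<rfloor> = c}) ` circle)"
proof -
  define e where "e i = frac (- (real i * \<alpha>))" for i :: nat
  define E where "E = e ` {l..l + m}"
  have pre: "rot_preimage \<alpha> i {0} = {e i}" for i
  proof (intro set_eqI iffI)
    fix y assume "y \<in> rot_preimage \<alpha> i {0}"
    then have y: "y \<in> circle" "y + real i * \<alpha> \<in> \<int>" by (auto simp: mem_rot_preimage)
    then have "- (real i * \<alpha>) - y \<in> \<int>" by (metis Ints_minus minus_add_distrib add.commute diff_conv_add_uminus)
    then have "frac (- (real i * \<alpha>)) = y" using y(1) unfolding frac_unique_iff by (simp add: circle_def)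
    then show "y \<in> {e i}" by (simp add: e_def)
  next
    fix y assume "y \<in> {e i}"
    then show "y \<in> rot_preimage \<alpha> i {0}" by (simp add: mem_rot_preimage e_def)
  qed
  have fl: "\<lfloor>y + real i * \<alpha>\<rfloor> = of_bool (e i \<le> y) - 1 - \<lfloor>- (real i * \<alpha>)\<rfloor>" if "y \<in> circle" for y i
  proof -
    have y: "0 \<le> y" "y < 1" using that by (auto simp: circle_def)
    have ei: "0 \<le> e i" "e i < 1" by (auto simp: e_def frac_lt_1)
    have "y + real i * \<alpha> = (y - e i) - of_int \<lfloor>- (real i * \<alpha>)\<rfloor>" by (simp add: e_def frac_def)
    then have "\<lfloor>y + real i * \<alpha>\<rfloor> = \<lfloor>y - e i\<rfloor> - \<lfloor>- (real i * \<alpha>)\<rfloor>"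
      by (simp only: floor_diff_of_int)
    moreover have "\<lfloor>y - e i\<rfloor> = of_bool (e i \<le> y) - 1" using y ei by (auto simp: floor_eq_iff)
    ultimately show ?thesis by simp
  qed
  \<comment> \<open>Two distinct endpoints: index \<open>l + 1\<close> is available since
    \<open>m \<ge> 1\<close>, and equality would make \<open>\<alpha>\<close> an integer.\<close>
  have "e l \<noteq> e (Suc l)"
  proof
    assume "e l = e (Suc l)"
    then have "- (real l * \<alpha>) - (- (real (Suc l) * \<alpha>)) \<in> \<int>"
      unfolding e_def by (metis frac_diff_zero frac_diff_eq frac_eq_0_iff)
    then have "\<alpha> \<in> \<int>" by (simp add: algebra_simps)
    then show False using irr Ints_subset_Rats by blast
  qed
  moreover have "e l \<in> E" "e (Suc l) \<in> E" using assms(2) by (auto simp: E_def)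
  moreover have "E \<subseteq> circle" "finite E" by (auto simp: E_def e_def)
  ultimately have "interval_partition E
    ((\<lambda>x. {y \<in> circle. \<exists>c::int. \<forall>e\<in>E. of_bool (e \<le> y) - of_bool (e \<le> x) = c}) ` circle)"
    by (intro interval_partition_cyclic_classes[of E "e l" "e (Suc l)"])
  moreover have "(\<exists>c::int. \<forall>e\<in>E. of_bool (e \<le> y) - of_bool (e \<le> x) = c) \<longleftrightarrow>
    (\<exists>c. \<forall>i\<in>{l..l + m}. \<lfloor>y + real i * \<alpha>\<rfloor> - \<lfloor>x + real i * \<alpha>\<rfloor> = c)" if "x \<in> circle" "y \<in> circle" for x y
  proof -
    have "of_bool (e i \<le> y) - of_bool (e i \<le> x) = \<lfloor>y + real i * \<alpha>\<rfloor> - \<lfloor>x + real i * \<alpha>\<rfloor>" for i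
      unfolding fl[OF that(1)] fl[OF that(2)] by simp
    then show ?thesis by (simp only: E_def ball_simps)
  qed
  then have "(\<lambda>x. {y \<in> circle. \<exists>c::int. \<forall>e\<in>E. of_bool (e \<le> y) - of_bool (e \<le> x) = c}) ` circle =
    (\<lambda>x. {y \<in> circle. \<exists>c. \<forall>i\<in>{l..l + m}. \<lfloor>y + real i * \<alpha>\<rfloor> - \<lfloor>x + real i * \<alpha>\<rfloor> = c}) ` circle"
    by (intro image_cong refl Collect_cong conj_cong) blast
  moreover have "(\<Union>i\<in>{l..l + m}. rot_preimage \<alpha> i {0}) = E" by (auto simp: pre E_def)
  ultimately show ?thesis by simp
qed

section \<open>Transfer to the refinements of \<open>\<R>\<close>\<close>

lemma constant_difference_commute:
  fixes u v :: "'a \<Rightarrow> 'b::ab_group_add"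
  shows "(\<exists>c. \<forall>i\<in>I. u i - v i = c) \<longleftrightarrow> (\<exists>c. \<forall>i\<in>I. v i - u i = c)"
proof -
  have "\<exists>c. \<forall>i\<in>I. v i - u i = c" if c: "\<forall>i\<in>I. u i - v i = c" for u v :: "'a \<Rightarrow> 'b" and c
  proof (intro exI ballI)
    fix i assume "i \<in> I"
    with c show "v i - u i = - c" by (metis minus_diff_eq)
  qed
  then show ?thesis by blast
qed

theorem theorem1:
  fixes \<alpha> :: real and n :: nat and \<R> :: "real set set"
  assumes "0 < \<alpha>" and "\<alpha> < 1" and "\<alpha> \<notin> \<rat>"
    and "1 \<le> n"
    and "partition_on circle \<R>"
    and "\<exists>A\<in>\<R>. \<exists>B\<in>\<R>. A \<noteq> B"
    and "refines circle (refinement \<alpha> n (rot_partition \<alpha>)) \<R>"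
  shows "\<exists>k l m :: nat. 1 \<le> k \<and> 1 \<le> m \<and> l < n \<and>
    refinement \<alpha> k \<R> = pull_partition \<alpha> l (refinement \<alpha> m (rot_partition \<alpha>)) \<and>
    pull_partition \<alpha> l (refinement \<alpha> m (rot_partition \<alpha>)) =
      refinement \<alpha> m (pull_partition \<alpha> l (rot_partition \<alpha>)) \<and>
    interval_partition (\<Union>i\<in>{l..l + m}. rot_preimage \<alpha> i {0}) (refinement \<alpha> k \<R>)"
proof -
  note R = assms(5)
  note P = partition_on_rot_partition[OF assms(1,2)]
  obtain \<delta> where \<delta>: "0 < \<delta>" "\<delta> \<le> 1"
    "\<And>i i' p p'. i \<le> n \<Longrightarrow> i' \<le> n \<Longrightarrow>
      \<bar>(of_int p - real i * \<alpha>) - (of_int p' - real i' * \<alpha>)\<bar> < \<delta> \<Longrightarrow> i = i' \<and> p = p'"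
    using irrational_orbit_gap[OF assms(3), of n] by blast
  \<comment> \<open>Equal floors of index 0 to \<open>n\<close> give a common cell of the
    \<open>n\<close>-th refinement of \<open>rot_partition \<alpha>\<close>, hence a common atom of
    the rougher \<open>\<R>\<close>.\<close>
  have const: "coding \<R> x = coding \<R> y"
    if eq: "\<And>i. i \<le> n \<Longrightarrow> \<lfloor>x + real i * \<alpha>\<rfloor> = \<lfloor>y + real i * \<alpha>\<rfloor>" for x y
  proof -
    define X where "X = {z \<in> circle. \<forall>j\<in>{..<n}. coding (rot_partition \<alpha>) (z + real j * \<alpha>) =
      coding (rot_partition \<alpha>) (frac x + real j * \<alpha>)}"
    have "\<forall>j\<in>{0..<0 + n}. coding (rot_partition \<alpha>) (y + real j * \<alpha>) = coding (rot_partition \<alpha>) (x + real j * \<alpha>)"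
      unfolding rot_partition_itinerary_iff[OF assms(1,2)] using eq by simp
    then have "frac x \<in> X" "frac y \<in> X" by (auto simp: X_def coding_frac)
    moreover have "X \<in> refinement \<alpha> n (rot_partition \<alpha>)"
      unfolding refinement_eq_cells[OF P assms(4)] cells_def X_def by (rule image_eqI) auto
    then obtain A where "A \<in> \<R>" "X \<subseteq> A" using assms(7) unfolding refines_def by blast
    ultimately show ?thesis using coding_eq_iff[OF R, of A y x] by auto
  qed
  interpret step_coloring \<alpha> \<delta> n "coding \<R>"
  proof
    show "coding \<R> (x + 1) = coding \<R> x" for x by (rule coding_cong) (simp add: frac_1_eq)
  qed (fact assms(3) const \<delta>)+
  obtain A B where AB: "A \<in> \<R>" "B \<in> \<R>" "A \<noteq> B" using assms(6) by blast
  then obtain a b where ab: "a \<in> A" "b \<in> B" using partition_onD3[OF R] by (metis ex_in_conv)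
  have circ: "a \<in> circle" "b \<in> circle" using AB ab partition_onD1[OF R] by auto
  have "a \<notin> B" using AB ab partition_onD2[OF R] by (auto simp: disjoint_def)
  then have "coding \<R> a \<noteq> coding \<R> b"
    using coding_eq_iff[OF R AB(2), of b a] ab circ by (simp add: frac_circle)
  from itinerary_iff[OF this] obtain k l m where klm: "1 \<le> k" "1 \<le> m" "l < n" and
    it: "\<forall>x y. x < y \<longrightarrow> y < x + 1 \<longrightarrow>
      (\<forall>j<k. coding \<R> (x + real j * \<alpha>) = coding \<R> (y + real j * \<alpha>)) \<longleftrightarrow>
      (\<exists>c. \<forall>i\<in>{l..l + m}. \<lfloor>y + real i * \<alpha>\<rfloor> - \<lfloor>x + real i * \<alpha>\<rfloor> = c)" .
  have same_iff: "(\<forall>j\<in>{..<k}. coding \<R> (y + real j * \<alpha>) = coding \<R> (x + real j * \<alpha>)) \<longleftrightarrow>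
      (\<exists>c. \<forall>i\<in>{l..l + m}. \<lfloor>y + real i * \<alpha>\<rfloor> - \<lfloor>x + real i * \<alpha>\<rfloor> = c)"
    if "x \<in> circle" "y \<in> circle" for x y
  proof -
    have comm: "(\<forall>j\<in>{..<k}. coding \<R> (y + real j * \<alpha>) = coding \<R> (x + real j * \<alpha>)) \<longleftrightarrow>
      (\<forall>j<k. coding \<R> (x + real j * \<alpha>) = coding \<R> (y + real j * \<alpha>))"
      by auto
    \<comment> \<open>The criterion \<open>it\<close> covers distinct representatives in increasing
      order; the reverse order follows by changing the sign of \<open>c\<close>.\<close>
    consider "x = y" | "x < y" | "y < x" by linarith
    then show ?thesis
    proof cases
      case 1
      then show ?thesis by simp
    next
      case 2
      then have "y < x + 1" using that by (simp add: circle_def)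
      from it[rule_format, OF 2 this] show ?thesis unfolding comm .
    next
      case 3
      then have "x < y + 1" using that by (simp add: circle_def)
      from it[rule_format, OF 3 this] show ?thesis
        unfolding constant_difference_commute[of _ _ "\<lambda>i. \<lfloor>x + real i * \<alpha>\<rfloor>"] by (simp add: Ball_def)
    qed
  qed
  \<comment> \<open>The common value of the partitions to be compared: itineraries of
    \<open>\<R>\<close> and of \<open>rot_partition \<alpha>\<close> lead to the same condition on
    floors.\<close>
  define Q where "Q = (\<lambda>x. {y \<in> circle. \<exists>c. \<forall>i\<in>{l..l + m}. \<lfloor>y + real i * \<alpha>\<rfloor> - \<lfloor>x + real i * \<alpha>\<rfloor> = c}) ` circle"
  have "refinement \<alpha> k \<R> = Q"
    unfolding refinement_eq_cells[OF R klm(1)] cells_def Q_def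
    by (intro image_cong refl Collect_cong conj_cong) (rule same_iff)
  moreover have "cells \<alpha> (rot_partition \<alpha>) {l..<l + m} = Q"
    unfolding cells_def Q_def rot_partition_itinerary_iff[OF assms(1,2)] ..
  moreover have "interval_partition (\<Union>i\<in>{l..l + m}. rot_preimage \<alpha> i {0}) Q"
    unfolding Q_def by (rule orbit_interval_partition[OF assms(3) klm(2)])
  ultimately show ?thesis
    using klm pull_refinement_eq_cells[OF P klm(2)] refinement_pull_eq_cells[OF P klm(2)] by metis
qed

end
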